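(* Let $k$ and $m$ be positive integers, let $G$ be a graph and let $T$ be a tree of order $m$. Suppose that $\delta(G) \ge k + m - 1$. (i) If $G$ is $k$-connected, then $G$ contains a subtree $T'$ isomorphic to $T$ such that $G - E(T')$ is $k$-connected. (ii) If $G$ is $k$-edge-connected, then $G$ contains a subtree $T'$ isomorphic to $T$ such that $G - E(T')$ is $k$-edge-connected.
   Context: All graphs are finite, undirected and simple. The order of a graph is its number of vertices. $\delta(G)$ is the minimum degree of $G$. A graph is $k$-connected if it has at least $k+1$ vertices and remains connected after deleting any set of fewer than $k$ vertices; it is $k$-edge-connected if it remains connected after deleting any set of fewer than $k$ edges. A subtree of $G$ is a (not necessarily induced) subgraph of $G$ that is a tree. $G - E(T')$ denotes the graph with vertex set $V(G)$ obtained by deleting the edges of $T'$ (no vertices are deleted). *)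

theory Defs
  imports "Graph_Theory.Pair_Digraph" "Graph_Theory.Digraph_Component"
    "Graph_Theory.Digraph_Isomorphism"
begin

text \<open>
  Finite simple graphs are rendered by \<^locale>\<open>pair_graph\<close>: a finite vertex set with a
  symmetric, irreflexive arc relation. An undirected edge is thus a pair of opposite arcs, and
  edge sets (for deletion and for counting) are sets of two-element vertex sets.
\<close>

definition uedges :: "'a pair_pre_digraph \<Rightarrow> 'a set set" where
  "uedges G = {{u, v} | u v. (u, v) \<in> parcs G}"

definition del_edges :: "'a pair_pre_digraph \<Rightarrow> 'a set set \<Rightarrow> 'a pair_pre_digraph" where
  "del_edges G F = \<lparr> pverts = pverts G, parcs = {(u, v) \<in> parcs G. {u, v} \<notin> F} \<rparr>"

text \<open>
  In a symmetric loopfree digraph the out-degree is the number of neighbours. The value for the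
  null graph is unspecified.
\<close>

definition min_degree :: "'a pair_pre_digraph \<Rightarrow> nat" where
  "min_degree G = Min (out_degree (with_proj G) ` pverts G)"

text \<open>
  The library constant \<^const>\<open>tree\<close> counts the closed walk u, v, u as a cycle, so no symmetric
  digraph with an edge satisfies it. Cycles of length at least 3 are those of the undirected graph.
  \<^const>\<open>Digraph_Component.connected\<close> includes nonemptiness of the vertex set.
\<close>

definition tree_graph :: "'a pair_pre_digraph \<Rightarrow> bool" where
  "tree_graph T \<longleftrightarrow> pair_graph T \<and> Digraph_Component.connected (with_proj T) \<and>
    \<not> (\<exists>p. pre_digraph.cycle (with_proj T) p \<and> 3 \<le> length p)"

definition subtree_of :: "'a pair_pre_digraph \<Rightarrow> 'a pair_pre_digraph \<Rightarrow> bool" where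
  "subtree_of T G \<longleftrightarrow> tree_graph T \<and> subgraph (with_proj T) (with_proj G)"

definition graph_isomorphic :: "'a pair_pre_digraph \<Rightarrow> 'b pair_pre_digraph \<Rightarrow> bool" where
  "graph_isomorphic G H \<longleftrightarrow> digraph_iso (with_proj G) (with_proj H)"

definition k_connected :: "nat \<Rightarrow> 'a pair_pre_digraph \<Rightarrow> bool" where
  "k_connected k G \<longleftrightarrow> k + 1 \<le> card (pverts G) \<and>
    (\<forall>S \<subseteq> pverts G. card S < k \<longrightarrow>
      Digraph_Component.connected (with_proj G \<restriction> (pverts G - S)))"

definition k_edge_connected :: "nat \<Rightarrow> 'a pair_pre_digraph \<Rightarrow> bool" where
  "k_edge_connected k G \<longleftrightarrow>
    (\<forall>F \<subseteq> uedges G. card F < k \<longrightarrow>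
      Digraph_Component.connected (with_proj (del_edges G F)))"

end

theory Submission
  imports Defs
begin

text \<open>
  Let \<open>N = k + m - 1\<close> and list the vertices of \<open>G\<close> in a maximum adjacency order: the next
  vertex is always one with the most neighbours among those already listed. Such an order has a
  strong local connectivity property: the number of earlier neighbours of a late vertex bounds from
  below the size of certain cuts, where a cut between disjoint sets \<open>Y\<close> and \<open>Z\<close> may use
  both the vertices outside \<open>Y \<union> Z\<close> and the edges between \<open>Y\<close> and \<open>Z\<close>
  (\<open>mixed_cut_prefix\<close>, \<open>back_degree_le_mixed_cut\<close>). Consequently, if \<open>X s\<close> denotes the
  final segment that starts at the last vertex with at most \<open>s\<close> earlier neighbours, then
  \<^item> these segments grow as \<open>s\<close> falls;
  \<^item> each vertex of \<open>X s\<close> has at most \<open>s\<close> neighbours outside \<open>X s\<close>;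
  \<^item> every mixed cut between disjoint sets that both meet \<open>X s\<close> has size greater than \<open>s\<close>
  (\<open>nested_regions\<close>).

  Enumerate the nodes of \<open>T\<close> so that each one except the root has exactly one earlier neighbour
  (\<open>tree_enumeration\<close>), and embed them greedily with both ends of the edge added by node
  \<open>q\<close> in \<open>X (N - q)\<close>. There is always room: the image of the parent has at least
  \<open>N - (N - q) = q\<close> neighbours in that segment, and at most \<open>q - 1\<close> of them are occupied
  (\<open>embed_in_nested_regions\<close>).

  Now let \<open>Y\<close> and \<open>Z\<close> be disjoint, and let \<open>q\<close> be the first tree edge between them, if
  there is one. The mixed cut has size at least \<open>N - q + 1 = k + (m - q)\<close>, and at most
  \<open>m - q\<close> tree edges are lost from it, so at least \<open>k\<close> remains after the deletion of the tree
  (\<open>tree_embedding_with_residual_cuts\<close>). If no tree edge runs between \<open>Y\<close> and \<open>Z\<close>, the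
  deletion does not affect this cut at all. Both kinds of \<open>k\<close>-connectedness are therefore
  inherited, vertex connectivity with the outside of \<open>Y \<union> Z\<close> as the separator and edge
  connectivity with an empty outside.
\<close>

section \<open>Cuts made of vertices and edges\<close>

definition degree_into :: "('a \<Rightarrow> 'a \<Rightarrow> bool) \<Rightarrow> 'a set \<Rightarrow> 'a \<Rightarrow> nat" where
  "degree_into adj W u = card {w \<in> W. adj w u}"

text \<open>
  Separating vertices and separating edges are counted together, so that one bound serves vertex
  and edge connectivity alike. For disjoint \<open>Y\<close> and \<open>Z\<close> each crossing edge is counted
  once. The ground set \<open>W\<close> is a parameter because the bounds below are proved by letting it
  grow along an ordering of the vertices.
\<close>

definition mixed_cut :: "('a \<Rightarrow> 'a \<Rightarrow> bool) \<Rightarrow> 'a set \<Rightarrow> 'a set \<Rightarrow> 'a set \<Rightarrow> nat" where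
  "mixed_cut adj W Y Z = card (W - Y - Z) + card {(a, b). a \<in> W \<inter> Y \<and> b \<in> W \<inter> Z \<and> adj a b}"

lemma degree_into_insert:
  assumes "finite W" "w \<notin> W"
  shows "degree_into adj (insert w W) u = degree_into adj W u + (if adj w u then 1 else 0)"
proof -
  have "{v \<in> insert w W. adj v u} = (if adj w u then insert w {v \<in> W. adj v u} else {v \<in> W. adj v u})"
    by auto
  then show ?thesis using assms by (simp add: degree_into_def)
qed

lemma finite_crossing: "finite W \<Longrightarrow> finite {(a, b). a \<in> W \<inter> Y \<and> b \<in> W \<inter> Z \<and> adj a b}"
  by (rule finite_subset[of _ "W \<times> W"]) auto

lemma mixed_cut_commute:
  assumes "symp adj"
  shows "mixed_cut adj W Y Z = mixed_cut adj W Z Y"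
proof -
  have "card {(a, b). a \<in> W \<inter> Y \<and> b \<in> W \<inter> Z \<and> adj a b}
      = card {(a, b). a \<in> W \<inter> Z \<and> b \<in> W \<inter> Y \<and> adj a b}"
    by (rule bij_betw_same_card[of prod.swap], rule bij_betwI[of _ _ _ prod.swap])
       (auto intro: sympD[OF assms])
  moreover have "W - Y - Z = W - Z - Y" by auto
  ultimately show ?thesis by (simp add: mixed_cut_def)
qed

lemma mixed_cut_insert_separator:
  assumes "finite W" "w \<notin> W" "w \<notin> Y" "w \<notin> Z"
  shows "mixed_cut adj (insert w W) Y Z = Suc (mixed_cut adj W Y Z)"
proof -
  have "insert w W - Y - Z = insert w (W - Y - Z)" using assms by auto
  moreover have "insert w W \<inter> Y = W \<inter> Y" "insert w W \<inter> Z = W \<inter> Z" using assms by auto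
  ultimately show ?thesis using assms by (simp add: mixed_cut_def)
qed

lemma mixed_cut_mono:
  assumes "finite W'" "W \<subseteq> W'"
  shows "mixed_cut adj W Y Z \<le> mixed_cut adj W' Y Z"
  unfolding mixed_cut_def using assms finite_crossing[of W' Y Z adj]
  by (intro add_mono card_mono) auto

lemma mixed_cut_insert_left:
  assumes "finite W" "x \<notin> W" "x \<in> Y" "Y \<inter> Z = {}" "y \<in> W" "y \<in> Z"
  shows "mixed_cut adj W Y Z + (if adj x y then 1 else 0) \<le> mixed_cut adj (insert x W) Y Z"
proof (cases "adj x y")
  case True
  let ?C = "\<lambda>W. {(a, b). a \<in> W \<inter> Y \<and> b \<in> W \<inter> Z \<and> adj a b}"
  have "insert (x, y) (?C W) \<subseteq> ?C (insert x W)" using True assms by auto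
  moreover have "finite (?C (insert x W))" using assms finite_crossing[of "insert x W" Y Z adj] by simp
  moreover have "(x, y) \<notin> ?C W" using assms by auto
  ultimately have "Suc (card (?C W)) \<le> card (?C (insert x W))"
    using finite_crossing[OF assms(1), of Y Z adj]
    by (metis (no_types, lifting) card_insert_disjoint card_mono)
  moreover have "insert x W - Y - Z = W - Y - Z" using assms by auto
  ultimately show ?thesis using True by (simp add: mixed_cut_def)
next
  case False
  then show ?thesis using mixed_cut_mono[of "insert x W" W] assms by auto
qed

lemma mixed_cut_insert_right:
  assumes "symp adj"
    and "finite W" "y \<notin> W" "y \<in> Z" "Y \<inter> Z = {}" "x \<in> W" "x \<in> Y"
  shows "mixed_cut adj W Y Z + (if adj x y then 1 else 0) \<le> mixed_cut adj (insert y W) Y Z"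
proof -
  have "adj x y \<longleftrightarrow> adj y x" using assms(1) by (auto dest: sympD)
  then show ?thesis
    using mixed_cut_insert_left[of W y Z Y x adj] assms(2-)
    by (simp add: mixed_cut_commute[OF assms(1), where Y=Y and Z=Z] Int_commute)
qed

section \<open>Maximum adjacency orders\<close>

text \<open>
  This is the order of Nagamochi and Ibaraki: the next vertex is always one with the most
  neighbours among the vertices already listed.
\<close>

definition max_adjacency_order :: "('a \<Rightarrow> 'a \<Rightarrow> bool) \<Rightarrow> 'a set \<Rightarrow> 'a list \<Rightarrow> bool" where
  "max_adjacency_order adj V xs \<longleftrightarrow> distinct xs \<and> set xs = V \<and>
     (\<forall>i < length xs. \<forall>u \<in> V - set (take i xs).
        degree_into adj (set (take i xs)) u \<le> degree_into adj (set (take i xs)) (xs ! i))"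

lemma max_adjacency_order_exists:
  assumes "finite V"
  shows "\<exists>xs. max_adjacency_order adj V xs"
proof -
  have "\<exists>xs. length xs = j \<and> distinct xs \<and> set xs \<subseteq> V \<and>
     (\<forall>i < j. \<forall>u \<in> V - set (take i xs).
        degree_into adj (set (take i xs)) u \<le> degree_into adj (set (take i xs)) (xs ! i))" if "j \<le> card V" for j
    using that
  proof (induction j)
    case 0
    then show ?case by simp
  next
    case (Suc j)
    then obtain xs where xs: "length xs = j" "distinct xs" "set xs \<subseteq> V"
      "\<And>i u. i < j \<Longrightarrow> u \<in> V - set (take i xs) \<Longrightarrow>
        degree_into adj (set (take i xs)) u \<le> degree_into adj (set (take i xs)) (xs ! i)" by auto
    have "card (set xs) < card V" using xs Suc.prems by (simp add: distinct_card)
    then have ne: "V - set xs \<noteq> {}" using xs(3) by auto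
    then obtain w where w: "w \<in> V - set xs" "\<forall>u \<in> V - set xs. degree_into adj (set xs) u \<le> degree_into adj (set xs) w"
      using finite_has_maximal[of "degree_into adj (set xs) ` (V - set xs)"] assms
      by (smt (verit) Max_ge Max_in empty_is_image finite_Diff finite_imageI imageE image_eqI)
    have "degree_into adj (set (take i (xs @ [w]))) u \<le> degree_into adj (set (take i (xs @ [w]))) ((xs @ [w]) ! i)"
      if "i < Suc j" "u \<in> V - set (take i (xs @ [w]))" for i u
    proof (cases "i = j")
      case True
      then show ?thesis using w that xs(1)[symmetric] by simp
    next
      case False
      then show ?thesis using that xs(1) xs(4)[of i u] by (simp add: nth_append)
    qed
    then show ?case using xs w by (intro exI[of _ "xs @ [w]"]) auto
  qed
  from this[OF order.refl] obtain xs where xs: "length xs = card V" "distinct xs" "set xs \<subseteq> V"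
     "\<forall>i < card V. \<forall>u \<in> V - set (take i xs).
        degree_into adj (set (take i xs)) u \<le> degree_into adj (set (take i xs)) (xs ! i)" by blast
  then have "set xs = V" using assms by (simp add: card_subset_eq distinct_card)
  then show ?thesis using xs by (auto simp: max_adjacency_order_def)
qed

lemma set_take_Suc: "i < length xs \<Longrightarrow> set (take (Suc i) xs) = insert (xs ! i) (set (take i xs))"
  by (simp add: take_Suc_conv_app_nth)

lemma nth_notin_take: "distinct xs \<Longrightarrow> i < length xs \<Longrightarrow> xs ! i \<notin> set (take i xs)"
  by (auto simp: in_set_conv_nth nth_eq_iff_index_eq)

text \<open>
  Here \<open>x\<close> and \<open>y\<close> are any two vertices beyond the prefix, and the induction is on the
  length of the prefix. Let \<open>w\<close> be the vertex that joins the prefix. If \<open>w\<close> lies outside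
  \<open>Y\<close> and \<open>Z\<close>, the cut gains a vertex while both back degrees gain at most one. If
  \<open>w\<close> lies in \<open>Y\<close>, the induction hypothesis is applied to \<open>w\<close> and \<open>y\<close>: by the
  choice of \<open>w\<close> the minimum of their back degrees is that of \<open>y\<close>, and the summand for the
  edge between \<open>w\<close> and \<open>y\<close> accounts for the growth of this back degree. Adding
  \<open>x\<close> then brings in the edge between \<open>x\<close> and \<open>y\<close>. The case of \<open>w\<close> in \<open>Z\<close> is
  symmetric.
\<close>

lemma mixed_cut_prefix:
  assumes adj: "symp adj"
    and ord: "max_adjacency_order adj V xs"
    and YZ: "Y \<inter> Z = {}"
  shows "i \<le> length xs \<Longrightarrow> x \<in> Y \<inter> (V - set (take i xs)) \<Longrightarrow> y \<in> Z \<inter> (V - set (take i xs)) \<Longrightarrow>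
    min (degree_into adj (set (take i xs)) x) (degree_into adj (set (take i xs)) y) + (if adj x y then 1 else 0)
      \<le> mixed_cut adj (insert x (insert y (set (take i xs)))) Y Z"
proof (induction i arbitrary: x y)
  case 0
  then have "x \<noteq> y" using YZ by auto
  then have "(if adj x y then 1 else 0) \<le> mixed_cut adj {x, y} Y Z"
    using mixed_cut_insert_left[of "{y}" x Y Z y adj] YZ 0 by (auto split: if_splits)
  then show ?case by (simp add: degree_into_def)
next
  case (Suc i)
  define w P where "w = xs ! i" and "P = set (take i xs)"
  have i: "i < length xs" and dist: "distinct xs" and V: "set xs = V"
    using Suc.prems ord by (auto simp: max_adjacency_order_def)
  have P': "set (take (Suc i) xs) = insert w P" using i by (simp add: set_take_Suc w_def P_def)
  have wP: "w \<in> V - P" using nth_notin_take[OF dist i] i V by (auto simp: w_def P_def)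
  have fin: "finite P" by (simp add: P_def)
  have wmax: "degree_into adj P u \<le> degree_into adj P w" if "u \<in> V - P" for u
    using ord i that by (auto simp: max_adjacency_order_def w_def P_def)
  have x: "x \<in> Y" "x \<in> V - P" "x \<noteq> w" and y: "y \<in> Z" "y \<in> V - P" "y \<noteq> w" and "x \<noteq> y"
    using Suc.prems P' YZ by auto
  have nb: "degree_into adj (insert w P) u = degree_into adj P u + (if adj w u then 1 else 0)" for u
    using fin wP by (simp add: degree_into_insert)
  note IH = Suc.IH[folded P_def]
  consider "w \<in> Y" | "w \<in> Z" | "w \<notin> Y" "w \<notin> Z" by blast
  then have "min (degree_into adj (insert w P) x) (degree_into adj (insert w P) y) + (if adj x y then 1 else 0)
      \<le> mixed_cut adj (insert x (insert y (insert w P))) Y Z"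
  proof cases
    case 1
    have "degree_into adj (insert w P) y \<le> mixed_cut adj (insert y (insert w P)) Y Z"
      using IH[of w y] 1 wP y i wmax[of y] by (simp add: nb insert_commute)
    moreover have "mixed_cut adj (insert y (insert w P)) Y Z + (if adj x y then 1 else 0)
        \<le> mixed_cut adj (insert x (insert y (insert w P))) Y Z"
      using x y \<open>x \<noteq> y\<close> fin YZ by (intro mixed_cut_insert_left) auto
    ultimately show ?thesis by linarith
  next
    case 2
    have "adj w x \<longleftrightarrow> adj x w" using adj by (auto dest: sympD)
    then have "degree_into adj (insert w P) x \<le> mixed_cut adj (insert x (insert w P)) Y Z"
      using IH[of x w] 2 wP x i wmax[of x] by (simp add: nb)
    moreover have "mixed_cut adj (insert x (insert w P)) Y Z + (if adj x y then 1 else 0)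
        \<le> mixed_cut adj (insert y (insert x (insert w P))) Y Z"
      using x y \<open>x \<noteq> y\<close> fin YZ by (intro mixed_cut_insert_right[OF adj]) auto
    ultimately show ?thesis by (simp add: insert_commute)
  next
    case 3
    have "mixed_cut adj (insert x (insert y (insert w P))) Y Z
        = Suc (mixed_cut adj (insert x (insert y P)) Y Z)"
      using 3 wP x y fin mixed_cut_insert_separator[of "insert x (insert y P)" w Y Z adj]
      by (simp add: insert_commute[of w])
    moreover have "degree_into adj (insert w P) x \<le> Suc (degree_into adj P x)"
      "degree_into adj (insert w P) y \<le> Suc (degree_into adj P y)" by (simp_all add: nb)
    moreover have "min (degree_into adj P x) (degree_into adj P y) + (if adj x y then 1 else 0)
        \<le> mixed_cut adj (insert x (insert y P)) Y Z"
      using IH[of x y] x y i by simp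
    ultimately show ?thesis by linarith
  qed
  then show ?case by (simp add: P')
qed

text \<open>
  When the last vertex \<open>w\<close> of the prefix lies in \<open>Y\<close>, the minimum in
  \<open>mixed_cut_prefix\<close> for the pair of \<open>w\<close> and \<open>y\<close> is attained by \<open>y\<close>, so that
  the whole back degree of \<open>y\<close> is bounded.
\<close>

lemma back_degree_le_mixed_cut_step:
  assumes adj: "symp adj"
    and ord: "max_adjacency_order adj V xs"
    and YZ: "Y \<inter> Z = {}"
    and l: "l < length xs" "xs ! l \<in> Y"
    and y: "y \<in> Z \<inter> (V - set (take (Suc l) xs))"
  shows "degree_into adj (set (take (Suc l) xs)) y \<le> mixed_cut adj (insert y (set (take (Suc l) xs))) Y Z"
proof -
  define w P where "w = xs ! l" and "P = set (take l xs)"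
  have P': "set (take (Suc l) xs) = insert w P" using l by (simp add: set_take_Suc w_def P_def)
  have wP: "w \<in> V - P"
    using nth_notin_take[of xs l] l ord by (auto simp: w_def P_def max_adjacency_order_def)
  have "degree_into adj P y \<le> degree_into adj P w"
    using ord l y P' by (auto simp: max_adjacency_order_def w_def P_def)
  moreover have "degree_into adj (insert w P) y = degree_into adj P y + (if adj w y then 1 else 0)"
    using wP by (intro degree_into_insert) (auto simp: P_def)
  ultimately show ?thesis
    using mixed_cut_prefix[OF adj ord YZ, of l w y] l wP y
    by (simp add: P' insert_commute flip: P_def w_def)
qed

text \<open>
  After a vertex of \<open>Y\<close> the prefix may take in vertices outside both sets. Each of them adds one
  to the cut and at most one to the back degree of \<open>y\<close>, so the bound persists; a further vertex
  of \<open>Y\<close> gives the bound afresh.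
\<close>

lemma back_degree_le_mixed_cut:
  assumes adj: "symp adj"
    and ord: "max_adjacency_order adj V xs"
    and YZ: "Y \<inter> Z = {}"
    and i: "xs ! i \<in> Y"
  shows "Suc i \<le> l \<Longrightarrow> l \<le> length xs \<Longrightarrow> (\<And>q. i < q \<Longrightarrow> q < l \<Longrightarrow> xs ! q \<notin> Z) \<Longrightarrow>
    y \<in> Z \<inter> (V - set (take l xs)) \<Longrightarrow>
    degree_into adj (set (take l xs)) y \<le> mixed_cut adj (insert y (set (take l xs))) Y Z"
proof (induction l rule: nat_induct_at_least)
  case base
  then show ?case using back_degree_le_mixed_cut_step[OF adj ord YZ, of i y] i by simp
next
  case (Suc l)
  show ?case
  proof (cases "xs ! l \<in> Y")
    case True
    then show ?thesis using back_degree_le_mixed_cut_step[OF adj ord YZ, of l y] Suc.prems by simp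
  next
    case False
    define w P where "w = xs ! l" and "P = set (take l xs)"
    have P': "set (take (Suc l) xs) = insert w P"
      using Suc.prems by (simp add: set_take_Suc w_def P_def)
    have wP: "w \<in> V - P"
      using nth_notin_take[of xs l] Suc.prems ord by (auto simp: w_def P_def max_adjacency_order_def)
    have wYZ: "w \<notin> Y" "w \<notin> Z" using False Suc.prems Suc.hyps by (auto simp: w_def)
    have "degree_into adj (insert w P) y \<le> Suc (degree_into adj P y)"
      using wP by (subst degree_into_insert) (auto simp: P_def)
    also have "degree_into adj P y \<le> mixed_cut adj (insert y P) Y Z"
      using Suc.IH Suc.prems P' by (simp add: P_def)
    also have "Suc (mixed_cut adj (insert y P) Y Z) = mixed_cut adj (insert w (insert y P)) Y Z"
      using wP wYZ Suc.prems P' by (intro mixed_cut_insert_separator[symmetric]) (auto simp: P_def)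
    finally show ?thesis by (simp add: P' insert_commute)
  qed
qed

section \<open>Nested regions that are hard to separate\<close>

text \<open>
  The region \<open>X s\<close> is the final segment of a maximum adjacency order that starts at the last
  vertex with at most \<open>s\<close> earlier neighbours. By the choice of that vertex, no vertex of the
  segment has more than \<open>s\<close> neighbours before the segment. Every later vertex has more than \<open>s\<close>
  earlier neighbours; this applies to the first vertex of one of \<open>Y\<close>, \<open>Z\<close> that follows a
  vertex of the other within the segment, and its back degree bounds the cut from below.
\<close>

lemma nested_regions:
  assumes fin: "finite V" and ne: "V \<noteq> {}"
    and adj: "symp adj"
  shows "\<exists>X :: nat \<Rightarrow> 'a set. (\<forall>s. X s \<subseteq> V) \<and> (\<forall>s. X s \<noteq> {}) \<and> antimono X \<and>
    (\<forall>s. \<forall>u \<in> X s. degree_into adj (V - X s) u \<le> s) \<and>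
    (\<forall>s Y Z. Y \<inter> Z = {} \<longrightarrow> Y \<inter> X s \<noteq> {} \<longrightarrow> Z \<inter> X s \<noteq> {} \<longrightarrow> s < mixed_cut adj V Y Z)"
proof -
  obtain xs where ord: "max_adjacency_order adj V xs" using max_adjacency_order_exists[OF fin, of adj] ..
  then have dist: "distinct xs" and V: "set xs = V"
    and mx: "\<And>i u. i < length xs \<Longrightarrow> u \<in> V - set (take i xs) \<Longrightarrow>
        degree_into adj (set (take i xs)) u \<le> degree_into adj (set (take i xs)) (xs ! i)"
    by (auto simp: max_adjacency_order_def)
  \<comment> \<open>The first vertex has no earlier neighbours, so that \<open>J s\<close> is never empty.\<close>
  define J where "J = (\<lambda>s. {i. i < length xs \<and> degree_into adj (set (take i xs)) (xs ! i) \<le> s})"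
  define X where "X = (\<lambda>s. set (drop (Max (J s)) xs))"
  have finJ: "finite (J s)" for s by (simp add: J_def)
  have "0 \<in> J s" for s using ne V by (auto simp: J_def degree_into_def)
  then have neJ: "J s \<noteq> {}" for s by blast
  have MaxJ: "Max (J s) \<in> J s" for s using finJ neJ by (rule Max_in)
  have X_compl: "V - X s = set (take (Max (J s)) xs)" for s
  proof -
    have "set (take n xs) \<inter> set (drop n xs) = {}" for n
      using dist by (metis append_take_drop_id distinct_append)
    moreover have "set (take n xs) \<union> set (drop n xs) = V" for n
      using V by (metis append_take_drop_id set_append)
    ultimately show ?thesis unfolding X_def by blast
  qed
  show ?thesis
  proof (intro exI[of _ X] conjI allI ballI impI)
    show "X s \<subseteq> V" for s using V by (auto simp: X_def dest: in_set_dropD)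
    show "X s \<noteq> {}" for s using MaxJ[of s] by (auto simp: X_def J_def)
    show "antimono X"
    proof (rule antimonoI)
      fix s s' :: nat assume "s \<le> s'"
      then have "Max (J s) \<le> Max (J s')" using neJ finJ by (intro Max_mono) (auto simp: J_def)
      then show "X s' \<subseteq> X s" by (simp add: X_def set_drop_subset_set_drop)
    qed
    show "degree_into adj (V - X s) u \<le> s" if "u \<in> X s" for s u
    proof -
      have "u \<in> V - set (take (Max (J s)) xs)"
        using that V X_compl[of s] by (auto simp: X_def dest: in_set_dropD)
      then show ?thesis using mx[of "Max (J s)" u] MaxJ[of s] by (auto simp: J_def X_compl)
    qed
    have large: "s < degree_into adj (set (take q xs)) (xs ! q)" if "Max (J s) < q" "q < length xs" for s q
    proof (rule ccontr)
      assume "\<not> ?thesis"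
      then have "q \<in> J s" using that by (simp add: J_def)
      then show False using Max_ge[OF finJ] that(1) by (meson leD)
    qed
    have *: "s < mixed_cut adj V Y Z"
      if YZ: "Y \<inter> Z = {}" and i: "Max (J s) \<le> i" "i < h" "h < length xs" "xs ! i \<in> Y" "xs ! h \<in> Z"
      for s i h Y Z
    proof -
      \<comment> \<open>The first vertex of \<open>Z\<close> after \<open>xs ! i\<close>, so that nothing between them is in \<open>Z\<close>.\<close>
      define l where "l = (LEAST l. i < l \<and> xs ! l \<in> Z)"
      have l: "i < l" "xs ! l \<in> Z" using LeastI[of "\<lambda>l. i < l \<and> xs ! l \<in> Z" h] i by (auto simp: l_def)
      have "l \<le> h" using i by (auto simp: l_def intro: Least_le)
      then have ln: "l < length xs" using i by simp
      have between: "xs ! q \<notin> Z" if "i < q" "q < l" for q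
        using not_less_Least[of q "\<lambda>l. i < l \<and> xs ! l \<in> Z"] that by (auto simp: l_def)
      have "s < degree_into adj (set (take l xs)) (xs ! l)" using large i l ln by simp
      also have "\<dots> \<le> mixed_cut adj (insert (xs ! l) (set (take l xs))) Y Z"
        using l ln between V nth_notin_take[OF dist ln] i
        by (intro back_degree_le_mixed_cut[OF adj ord YZ]) auto
      also have "\<dots> \<le> mixed_cut adj V Y Z"
        using fin V ln by (intro mixed_cut_mono) (auto dest: in_set_takeD)
      finally show ?thesis .
    qed
    show "s < mixed_cut adj V Y Z" if YZ: "Y \<inter> Z = {}" "Y \<inter> X s \<noteq> {}" "Z \<inter> X s \<noteq> {}" for s Y Z
    proof -
      have idx: "\<exists>i. Max (J s) \<le> i \<and> i < length xs \<and> xs ! i = u" if "u \<in> X s" for u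
      proof -
        have "u \<in> set (drop (Max (J s)) xs)" using that by (simp add: X_def)
        then obtain r where "r < length (drop (Max (J s)) xs)" "drop (Max (J s)) xs ! r = u"
          unfolding in_set_conv_nth by blast
        then show ?thesis by (intro exI[of _ "Max (J s) + r"]) auto
      qed
      obtain i h where i: "Max (J s) \<le> i" "i < length xs" "xs ! i \<in> Y"
        and h: "Max (J s) \<le> h" "h < length xs" "xs ! h \<in> Z"
        using YZ idx by (metis disjoint_iff)
      have "i \<noteq> h" using i h YZ by auto
      then consider "i < h" | "h < i" by linarith
      then show ?thesis
      proof cases
        case 1
        then show ?thesis using * YZ i h by blast
      next
        case 2
        then have "s < mixed_cut adj V Z Y" using *[of Z Y s h i] YZ i h by (simp add: Int_commute)
        then show ?thesis by (simp add: mixed_cut_commute[OF adj, where Y=Y and Z=Z])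
      qed
    qed
  qed
qed

text \<open>
  Nodes are placed greedily, node \<open>i\<close> next to its parent and with both ends of the new edge in
  \<open>X (N - i)\<close>. The image of the parent has at least \<open>N\<close> neighbours, at most
  \<open>N - i\<close> of them outside this region, hence at least \<open>i\<close> inside; only
  \<open>i - 1\<close> of those can be images of other nodes. Since the regions grow as their index falls, all
  nodes placed so far stay inside the current region.
\<close>

lemma embed_in_nested_regions:
  fixes V :: "'a set" and X :: "nat \<Rightarrow> 'a set"
  assumes fin: "finite V"
    and adj: "symp adj" "irreflp adj"
    and deg: "\<forall>u \<in> V. N \<le> degree_into adj V u"
    and X: "\<forall>s. X s \<subseteq> V" "\<forall>s. X s \<noteq> {}" "antimono X" "\<forall>s. \<forall>u \<in> X s. degree_into adj (V - X s) u \<le> s"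
    and m: "m \<le> N"
    and par: "\<forall>i. 0 < i \<longrightarrow> i < m \<longrightarrow> par i < i"
  shows "\<exists>g. inj_on g {..<m} \<and> g ` {..<m} \<subseteq> V \<and>
    (\<forall>q. 0 < q \<longrightarrow> q < m \<longrightarrow> g q \<in> X (N - q) \<and> g (par q) \<in> X (N - q) \<and> adj (g (par q)) (g q))"
proof -
  have "\<exists>g. inj_on g {..<i} \<and> g ` {..<i} \<subseteq> X (N - i) \<and>
    (\<forall>q. 0 < q \<longrightarrow> q < i \<longrightarrow> g q \<in> X (N - q) \<and> g (par q) \<in> X (N - q) \<and> adj (g (par q)) (g q))"
    if "i \<le> m" for i
    using that
  proof (induction i)
    case 0
    then show ?case by simp
  next
    case (Suc i)
    have XX: "X (N - i) \<subseteq> X (N - Suc i)" using antimonoD[OF X(3), of "N - Suc i" "N - i"] by simp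
    show ?case
    proof (cases "i = 0")
      case True
      obtain r where "r \<in> X (N - Suc 0)" using X(2) by blast
      then show ?thesis using True by (intro exI[of _ "\<lambda>_. r"]) (auto simp: inj_on_def)
    next
      case False
      obtain g where g: "inj_on g {..<i}" "g ` {..<i} \<subseteq> X (N - i)"
        "\<And>q. 0 < q \<Longrightarrow> q < i \<Longrightarrow> g q \<in> X (N - q) \<and> g (par q) \<in> X (N - q) \<and> adj (g (par q)) (g q)"
        using Suc.IH Suc.prems by auto
      have pi: "par i < i" using par False Suc.prems by simp
      define u where "u = g (par i)"
      have uX: "u \<in> X (N - i)" using g(2) pi by (auto simp: u_def)
      have "\<exists>w. w \<in> X (N - i) \<and> w \<notin> g ` {..<i} \<and> adj u w"
      proof (rule ccontr)
        assume none: "\<not> ?thesis"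
        have "{w \<in> V. adj w u} \<subseteq> {w \<in> V - X (N - i). adj w u} \<union> (g ` {..<i} - {u})"
          using none adj by (auto dest: sympD irreflpD)
        then have "degree_into adj V u \<le> card ({w \<in> V - X (N - i). adj w u} \<union> (g ` {..<i} - {u}))"
          unfolding degree_into_def using fin by (intro card_mono) auto
        also have "\<dots> \<le> degree_into adj (V - X (N - i)) u + card (g ` {..<i} - {u})"
          unfolding degree_into_def by (rule card_Un_le)
        also have "card (g ` {..<i} - {u}) = i - 1"
          using g(1) pi by (simp add: u_def card_image)
        also have "degree_into adj (V - X (N - i)) u \<le> N - i" using X(4) uX by simp
        finally have "N \<le> N - i + (i - 1)" using deg uX X(1) by fastforce
        then show False using False Suc.prems m by simp
      qed
      then obtain w where w: "w \<in> X (N - i)" "w \<notin> g ` {..<i}" "adj u w" by blast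
      have "inj_on (g(i := w)) {..<Suc i}"
        using g(1) w(2) by (auto simp: lessThan_Suc inj_on_def)
      moreover have "(g(i := w)) ` {..<Suc i} \<subseteq> X (N - Suc i)"
        using g(2) w(1) XX by (auto simp: lessThan_Suc)
      moreover have "(g(i := w)) q \<in> X (N - q) \<and> (g(i := w)) (par q) \<in> X (N - q)
          \<and> adj ((g(i := w)) (par q)) ((g(i := w)) q)" if "0 < q" "q < Suc i" for q
      proof (cases "q = i")
        case True
        then show ?thesis using w uX pi by (simp add: u_def)
      next
        case neq: False
        then have "q < i" "par q < i" using that par Suc.prems less_trans[of "par q" q i] by auto
        then show ?thesis using g(3)[of q] that by simp
      qed
      ultimately show ?thesis by blast
    qed
  qed
  from this[OF order.refl] obtain g where "inj_on g {..<m}" "g ` {..<m} \<subseteq> X (N - m)"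
    "\<forall>q. 0 < q \<longrightarrow> q < m \<longrightarrow> g q \<in> X (N - q) \<and> g (par q) \<in> X (N - q) \<and> adj (g (par q)) (g q)"
    by blast
  then show ?thesis using X(1) by blast
qed

section \<open>Connectedness through crossing arcs\<close>

text \<open>
  Connectedness is used in this form, as the existence of an arc across each partition of the
  vertices into two nonempty parts, both to enumerate a tree and to compare connectivity before
  and after a deletion of edges.
\<close>

lemma connected_crossing_arc:
  assumes con: "Digraph_Component.connected H"
    and A: "A \<subseteq> verts H" "A \<noteq> {}" "A \<noteq> verts H"
  obtains a b where "a \<in> A" "b \<in> verts H - A" "(a, b) \<in> arcs_ends H \<or> (b, a) \<in> arcs_ends H"
proof -
  obtain u v where uv: "u \<in> A" "v \<in> verts H - A" using A by blast
  have "\<exists>a \<in> A. \<exists>b \<in> verts H - A. (a, b) \<in> symcl (arcs_ends H)"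
  proof (rule ccontr)
    assume none: "\<not> ?thesis"
    have "(u, v) \<in> rtrancl_on (verts H) (symcl (arcs_ends H))"
      using con uv A unfolding connected_conv by blast
    then have "v \<in> A"
      using uv(1)
    proof (induction rule: rtrancl_on_induct)
      case (step b c)
      then show ?case using none by blast
    qed simp
    then show False using uv by simp
  qed
  then show thesis using that by (auto simp: symcl_def)
qed

lemma connected_if_crossing_arcs:
  assumes ne: "verts H \<noteq> {}"
    and cross: "\<And>A. A \<subseteq> verts H \<Longrightarrow> A \<noteq> {} \<Longrightarrow> A \<noteq> verts H \<Longrightarrow>
      \<exists>a \<in> A. \<exists>b \<in> verts H - A. (a, b) \<in> arcs_ends H \<or> (b, a) \<in> arcs_ends H"
  shows "Digraph_Component.connected H"
  unfolding connected_conv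
proof (intro conjI ne ballI)
  fix u v assume uv: "u \<in> verts H" "v \<in> verts H"
  define A where "A = {w. (u, w) \<in> rtrancl_on (verts H) (symcl (arcs_ends H))}"
  have "A \<subseteq> verts H" by (auto simp: A_def dest: in_rtrancl_on_in_F)
  moreover have "u \<in> A" using uv by (simp add: A_def)
  moreover have False if a: "a \<in> A" "b \<in> verts H - A" "(a, b) \<in> arcs_ends H \<or> (b, a) \<in> arcs_ends H" for a b
  proof -
    have "(a, b) \<in> symcl (arcs_ends H)" using a by (auto simp: symcl_def)
    then have "b \<in> A"
      using a by (auto simp: A_def intro: rtrancl_on_into_rtrancl_on)
    then show False using a by simp
  qed
  ultimately have "A = verts H" using cross[of A] by blast
  then show "(u, v) \<in> rtrancl_on (verts H) (symcl (arcs_ends H))" using uv by (auto simp: A_def)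
qed

lemma connected_induced_crossing_arc:
  assumes "sym (parcs H)" "Digraph_Component.connected (with_proj H \<restriction> U)"
    and "Y \<union> Z = U" "Y \<inter> Z = {}" "Y \<noteq> {}" "Z \<noteq> {}"
  shows "(Y \<times> Z) \<inter> parcs H \<noteq> {}"
proof -
  have "Y \<subseteq> verts (with_proj H \<restriction> U)" "Y \<noteq> verts (with_proj H \<restriction> U)" using assms(3-) by auto
  then obtain a b where "a \<in> Y" "b \<in> verts (with_proj H \<restriction> U) - Y"
    "(a, b) \<in> arcs_ends (with_proj H \<restriction> U) \<or> (b, a) \<in> arcs_ends (with_proj H \<restriction> U)"
    using connected_crossing_arc[OF assms(2)] assms(5) by metis
  then have "a \<in> Y" "b \<in> U - Y" "(a, b) \<in> parcs H \<or> (b, a) \<in> parcs H"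
    by (auto simp: arcs_ends_def arc_to_ends_def)
  then show ?thesis using assms(1,3,4) by (auto dest: symD)
qed

lemma connected_induced_if_crossing_arcs:
  assumes "U \<noteq> {}"
    and cross: "\<And>Y Z. Y \<union> Z = U \<Longrightarrow> Y \<inter> Z = {} \<Longrightarrow> Y \<noteq> {} \<Longrightarrow> Z \<noteq> {} \<Longrightarrow> (Y \<times> Z) \<inter> parcs H \<noteq> {}"
  shows "Digraph_Component.connected (with_proj H \<restriction> U)"
proof (rule connected_if_crossing_arcs)
  fix A assume A: "A \<subseteq> verts (with_proj H \<restriction> U)" "A \<noteq> {}" "A \<noteq> verts (with_proj H \<restriction> U)"
  then obtain a b where "a \<in> A" "b \<in> U - A" "(a, b) \<in> parcs H"
    using cross[of A "U - A"] by auto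
  then show "\<exists>a \<in> A. \<exists>b \<in> verts (with_proj H \<restriction> U) - A.
      (a, b) \<in> arcs_ends (with_proj H \<restriction> U) \<or> (b, a) \<in> arcs_ends (with_proj H \<restriction> U)"
    using A by (force simp: arcs_ends_def arc_to_ends_def)
qed (use assms in simp)

lemma induce_all_vertices:
  assumes "\<And>e. e \<in> parcs H \<Longrightarrow> fst e \<in> pverts H \<and> snd e \<in> pverts H"
  shows "with_proj H \<restriction> pverts H = with_proj H"
  using assms by (auto simp: induce_subgraph_def with_proj_def)

section \<open>Enumerations and injective images of trees\<close>

lemma last_pawalk_verts: "pcas a p b \<Longrightarrow> last (pawalk_verts a p) = b"
proof (induction p arbitrary: a)
  case (Cons e p)
  moreover have "pawalk_verts (snd e) p \<noteq> []" by (cases p) simp_all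
  ultimately show ?case by simp
qed simp

lemma set_tl_subset: "set (tl xs) \<subseteq> set xs"
  by (cases xs) auto

lemma pawalk_verts_snoc: "pcas a p b \<Longrightarrow> pawalk_verts a (p @ [(b, w)]) = pawalk_verts a p @ [w]"
  by (induction p arbitrary: a) auto

text \<open>
  The enumeration grows a subtree from a root: connectedness supplies an edge from the current
  vertex set \<open>A\<close> to a new vertex \<open>w\<close>. A second neighbour of \<open>w\<close> in \<open>A\<close> would
  close a cycle of length at least 3 through a path inside \<open>A\<close>; so the induction also carries
  the fact that any two vertices of \<open>A\<close> are joined by a path in \<open>A\<close>.
\<close>

lemma tree_enumeration:
  assumes tree: "tree_graph T"
  shows "\<exists>(t :: nat \<Rightarrow> 'b) par. bij_betw t {..<card (pverts T)} (pverts T) \<and>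
    (\<forall>i. 0 < i \<longrightarrow> i < card (pverts T) \<longrightarrow> par i < i) \<and>
    (\<forall>p i. p < i \<longrightarrow> i < card (pverts T) \<longrightarrow> ((t p, t i) \<in> parcs T \<longleftrightarrow> p = par i))"
proof -
  interpret T: pair_graph T using tree by (simp add: tree_graph_def)
  have con: "Digraph_Component.connected (with_proj T)" using tree by (simp add: tree_graph_def)
  have sym: "(b, a) \<in> parcs T" if "(a, b) \<in> parcs T" for a b
    using T.graph_symmetric that by simp
  have "\<exists>t par. inj_on t {..<j} \<and> t ` {..<j} \<subseteq> pverts T \<and>
      (\<forall>i. 0 < i \<longrightarrow> i < j \<longrightarrow> par i < i) \<and>
      (\<forall>p i. p < i \<longrightarrow> i < j \<longrightarrow> ((t p, t i) \<in> parcs T \<longleftrightarrow> p = par i)) \<and>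
      (\<forall>a \<in> t ` {..<j}. \<forall>b \<in> t ` {..<j}. \<exists>p. T.apath a p b \<and> set (pawalk_verts a p) \<subseteq> t ` {..<j})"
    if "j \<le> card (pverts T)" for j
    using that
  proof (induction j)
    case 0
    then show ?case by simp
  next
    case (Suc j)
    from Suc.IH[OF Suc_leD[OF Suc.prems]] obtain t :: "nat \<Rightarrow> 'b" and par where inj: "inj_on t {..<j}" and tV: "t ` {..<j} \<subseteq> pverts T"
      and par: "\<forall>i. 0 < i \<longrightarrow> i < j \<longrightarrow> par i < i"
      and arcs: "\<forall>p i. p < i \<longrightarrow> i < j \<longrightarrow> ((t p, t i) \<in> parcs T \<longleftrightarrow> p = par i)"
      and path: "\<forall>a \<in> t ` {..<j}. \<forall>b \<in> t ` {..<j}.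
        \<exists>p. T.apath a p b \<and> set (pawalk_verts a p) \<subseteq> t ` {..<j}"
      by (elim exE conjE)
    show ?case
    proof (cases "j = 0")
      case True
      obtain r where r: "r \<in> pverts T" using con by (auto simp: connected_conv)
      have "T.apath r [] r" using r by (simp add: T.apath_Nil_iff)
      then show ?thesis using True r
        by (intro exI[of _ "\<lambda>_. r"] exI[of _ "\<lambda>_. 0"]) (auto simp: inj_on_def intro!: exI[of _ "[]"])
    next
      case False
      let ?A = "t ` {..<j}"
      have "card ?A = j" using inj by (simp add: card_image)
      then have "?A \<noteq> pverts T" using Suc.prems by auto
      then obtain a w where aw: "a \<in> ?A" "w \<in> pverts T - ?A" "(a, w) \<in> parcs T"
        using connected_crossing_arc[OF con, of ?A] tV False sym
        by (metis empty_is_image lessThan_empty_iff with_proj_simps(1,3))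
      have uniq: "b = a" if b: "b \<in> ?A" "(b, w) \<in> parcs T" for b
      proof (rule ccontr)
        assume "b \<noteq> a"
        obtain p where p: "T.apath a p b" "set (pawalk_verts a p) \<subseteq> ?A" using path aw b by blast
        then have "p \<noteq> []" using \<open>b \<noteq> a\<close> by (auto simp: T.apath_def T.awalk_def)
        \<comment> \<open>From \<open>w\<close> to \<open>a\<close>, along \<open>p\<close> to \<open>b\<close>, and back to \<open>w\<close>; \<open>p\<close> is nonempty, hence three arcs.\<close>
        let ?c = "(w, a) # p @ [(b, w)]"
        have pc: "pcas a p b" "set p \<subseteq> parcs T" "distinct (pawalk_verts a p)"
          using p by (auto simp: T.apath_def T.awalk_def)
        have "T.awalk w ?c w"
          using pc aw sym b by (auto simp: T.awalk_def last_pawalk_verts)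
        moreover have "distinct (tl (pawalk_verts w ?c))"
          using pc p(2) aw by (auto simp: pawalk_verts_snoc)
        ultimately have "T.cycle ?c" by (auto simp: T.cycle_def)
        moreover have "3 \<le> length ?c" using \<open>p \<noteq> []\<close> by (cases p) auto
        ultimately show False using tree unfolding tree_graph_def by blast
      qed
      obtain q where q: "q < j" "t q = a" using aw by auto
      define t' where "t' = t(j := w)"
      define par' where "par' = par(j := q)"
      have t': "t' i = t i" "par' i = par i" if "i < j" for i using that by (simp_all add: t'_def par'_def)
      have t'j: "t' j = w" "par' j = q" by (simp_all add: t'_def par'_def)
      have img: "t' ` {..<Suc j} = insert w ?A"
        by (auto simp: lessThan_Suc t'j t' image_iff)
      have "inj_on t' {..<Suc j}"
        using inj aw(2) by (auto simp: lessThan_Suc inj_on_def t' t'j)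
      moreover have "t' ` {..<Suc j} \<subseteq> pverts T" using img tV aw by auto
      moreover have "\<forall>i. 0 < i \<longrightarrow> i < Suc j \<longrightarrow> par' i < i"
        using par q by (auto simp: less_Suc_eq t' t'j)
      moreover have "(t' p, t' i) \<in> parcs T \<longleftrightarrow> p = par' i" if "p < i" "i < Suc j" for p i
      proof (cases "i = j")
        case True
        have "(t p, w) \<in> parcs T \<longleftrightarrow> p = q"
          using uniq[of "t p"] q aw(3) that True inj by (auto dest: inj_onD)
        then show ?thesis using True that by (simp add: t' t'j)
      next
        case False
        then show ?thesis using arcs that by (simp add: t')
      qed
      moreover have "\<exists>p. T.apath x p y \<and> set (pawalk_verts x p) \<subseteq> insert w ?A"
        if "x \<in> insert w ?A" "y \<in> insert w ?A" for x y
      proof -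
        consider "x \<in> ?A" "y \<in> ?A" | "x = w" "y \<in> ?A" | "x \<in> ?A" "y = w" | "x = w" "y = w"
          using \<open>x \<in> insert w ?A\<close> \<open>y \<in> insert w ?A\<close> by blast
        then show ?thesis
        proof cases
          case 1
          then show ?thesis using path by blast
        next
          case 2
          then obtain p where "T.apath a p y" "set (pawalk_verts a p) \<subseteq> ?A" using path aw by blast
          then show ?thesis using 2 aw sym
            by (intro exI[of _ "(w, a) # p"]) (auto simp: T.apath_def T.awalk_def)
        next
          case 3
          then obtain p where "T.apath x p a" "set (pawalk_verts x p) \<subseteq> ?A" using path aw by blast
          then show ?thesis using 3 aw
            by (intro exI[of _ "p @ [(a, w)]"])
              (auto simp: T.apath_def T.awalk_def last_pawalk_verts pawalk_verts_snoc)
        next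
          case 4
          then show ?thesis using aw by (intro exI[of _ "[]"]) (auto simp: T.apath_def T.awalk_def)
        qed
      qed
      ultimately show ?thesis
        unfolding img[symmetric] by (intro exI[of _ t'] exI[of _ par'] conjI) simp_all
    qed
  qed
  from this[OF order.refl] obtain t :: "nat \<Rightarrow> 'b" and par where
    t: "inj_on t {..<card (pverts T)}" "t ` {..<card (pverts T)} \<subseteq> pverts T"
      "\<forall>i. 0 < i \<longrightarrow> i < card (pverts T) \<longrightarrow> par i < i"
      "\<forall>p i. p < i \<longrightarrow> i < card (pverts T) \<longrightarrow> ((t p, t i) \<in> parcs T \<longleftrightarrow> p = par i)"
    by (elim exE conjE) (rule that)
  have "t ` {..<card (pverts T)} = pverts T"
    using t T.pair_finite_verts by (intro card_subset_eq) (auto simp: card_image)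
  then show ?thesis using t by (intro exI[of _ t] exI[of _ par]) (auto simp: bij_betw_def)
qed

text \<open>
  Acyclicity of the image is proved by pulling a cycle back along the inverse isomorphism, which
  preserves its length.
\<close>

lemma graph_image_of_tree:
  assumes tree: "tree_graph T" and inj: "inj_on f (pverts T)"
  defines "T' \<equiv> \<lparr>pverts = f ` pverts T, parcs = (\<lambda>(u, v). (f u, f v)) ` parcs T\<rparr>"
  shows "tree_graph T'" "graph_isomorphic T T'"
proof -
  interpret T: pair_graph T using tree by (simp add: tree_graph_def)
  define hom where "hom = \<lparr>iso_verts = f, iso_arcs = (\<lambda>(u, v). (f u, f v)), iso_head = snd, iso_tail = fst\<rparr>"
  have "inj_on (\<lambda>(u, v). (f u, f v)) (parcs T)"
    using inj by (auto simp: inj_on_def dest: T.in_arcsD1 T.in_arcsD2)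
  then have hom: "T.digraph_isomorphism hom"
    using inj T.wf_digraph_axioms by (auto simp: T.digraph_isomorphism_def hom_def)
  have app: "with_proj T' = app_iso hom (with_proj T)"
    by (simp add: T'_def hom_def with_proj_def app_iso_def)
  show iso: "graph_isomorphic T T'"
    unfolding graph_isomorphic_def digraph_iso_def using hom app by blast
  have "pair_graph T'"
  proof
    show "finite (pverts T')" "finite (parcs T')" by (simp_all add: T'_def)
    show "fst e \<in> pverts T'" "snd e \<in> pverts T'" if "e \<in> parcs T'" for e
      using that by (auto simp: T'_def dest: T.in_arcsD1 T.in_arcsD2)
    show "fst e \<noteq> snd e" if "e \<in> parcs T'" for e
      using that inj T.pair_no_loops
      by (fastforce simp: T'_def dest: T.in_arcsD1 T.in_arcsD2 inj_onD)
    have "sym (parcs T')"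
      using T.graph_symmetric by (force simp: sym_def T'_def)
    then show "symmetric (with_proj T')" by (simp add: symmetric_def)
  qed
  moreover have "Digraph_Component.connected (with_proj T')"
    unfolding app using tree hom by (intro T.connectedI_app_iso) (simp_all add: tree_graph_def)
  moreover have False if c: "pre_digraph.cycle (with_proj T') p" "3 \<le> length p" for p
  proof -
    interpret T': pair_graph T' by fact
    define bk where "bk = T.inv_iso hom"
    have bk: "T'.digraph_isomorphism bk"
      unfolding bk_def app using hom by (rule T.digraph_isomorphism_invI)
    have inverse_app: "app_iso bk (with_proj T') = with_proj T"
      unfolding bk_def app using hom by (rule T.app_iso_inv)
    obtain u where u: "T'.awalk u p u" "distinct (tl (pawalk_verts u p))" "p \<noteq> []"
      using c by (auto simp: T'.cycle_def)
    let ?u = "iso_verts bk u" and ?p = "map (iso_arcs bk) p"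
    have "T.awalk ?u ?p ?u" using T'.awalk_app_isoI[OF u(1) bk] by (simp add: inverse_app)
    moreover have verts: "pawalk_verts ?u ?p = map (iso_verts bk) (pawalk_verts u p)"
      using T'.awalk_verts_app_iso_eq[OF bk u(1)] by (simp add: inverse_app)
    have "set (tl (pawalk_verts u p)) \<subseteq> pverts T'"
      using T'.awalk_verts_in_verts[of u p] u(1) set_tl_subset[of "pawalk_verts u p"]
      by (auto simp: T'.awalk_def)
    then have "inj_on (iso_verts bk) (set (tl (pawalk_verts u p)))"
      using T'.digraph_isomorphism_inj_on_verts[OF bk] by (auto intro: inj_on_subset)
    then have "distinct (tl (pawalk_verts ?u ?p))"
      using u by (simp add: verts distinct_map flip: map_tl)
    ultimately have "T.cycle ?p" using u(3) unfolding T.cycle_def by blast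
    then show False using tree c(2) unfolding tree_graph_def by (metis length_map)
  qed
  ultimately show "tree_graph T'" unfolding tree_graph_def by blast
qed

section \<open>Deleting a tree from a graph of large minimum degree\<close>

text \<open>
  Number the edges of the tree by the node that they add, so that edge \<open>q\<close> lies in
  \<open>X (N - q)\<close> with \<open>N = k + m - 1\<close>. If \<open>q\<close> is the first edge of the copy that crosses
  from \<open>Y\<close> to \<open>Z\<close>, both sets meet \<open>X (N - q)\<close>, and the mixed cut in \<open>G\<close> is at
  least \<open>N - q + 1 = k + (m - q)\<close>. At most the \<open>m - q\<close> edges
  \<open>q, \<dots>, m - 1\<close> of the copy cross, so at least \<open>k\<close> of the cut survives.
\<close>

lemma tree_embedding_with_residual_cuts:
  fixes G :: "'a pair_pre_digraph" and T :: "'b pair_pre_digraph"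
  assumes G: "pair_graph G" "pverts G \<noteq> {}" and T: "tree_graph T"
    and k: "k \<ge> 1" and deg: "min_degree G \<ge> k + card (pverts T) - 1"
  shows "\<exists>T'. subtree_of T' G \<and> graph_isomorphic T T' \<and>
    (\<forall>Y Z. Y \<inter> Z = {} \<longrightarrow> (Y \<times> Z) \<inter> parcs T' \<noteq> {} \<longrightarrow>
      k \<le> card (pverts G - Y - Z) + card ((Y \<times> Z) \<inter> (parcs G - parcs T')))"
proof -
  interpret G: pair_graph G by fact
  interpret T: pair_graph T using T by (simp add: tree_graph_def)
  define m where "m = card (pverts T)"
  define N where "N = k + m - 1"
  define V where "V = pverts G"
  define adj where "adj = (\<lambda>a b. (a, b) \<in> parcs G)"
  have fin: "finite V" and ne: "V \<noteq> {}" using G by (simp_all add: V_def)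
  have sym: "symp adj" using G.graph_symmetric by (auto simp: adj_def symp_def)
  have irrefl: "irreflp adj" using G.pair_no_loops by (force simp: adj_def irreflp_def)
  have m: "m \<le> N" using k by (simp add: N_def)
  have degN: "\<forall>u \<in> V. N \<le> degree_into adj V u"
  proof
    fix u assume "u \<in> V"
    have "min_degree G \<le> out_degree (with_proj G) u"
      using \<open>u \<in> V\<close> fin unfolding min_degree_def V_def by (intro Min_le) auto
    also have "out_degree (with_proj G) u = card {w \<in> V. adj w u}"
      unfolding out_degree_def
    proof (rule bij_betw_same_card[of snd], rule bij_betwI[of _ _ _ "\<lambda>w. (u, w)"])
      show "snd \<in> out_arcs (with_proj G) u \<rightarrow> {w \<in> V. adj w u}"
        using G.graph_symmetric by (auto simp: out_arcs_def V_def adj_def dest: G.in_arcsD2)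
      show "(\<lambda>w. (u, w)) \<in> {w \<in> V. adj w u} \<rightarrow> out_arcs (with_proj G) u"
        using G.graph_symmetric by (auto simp: out_arcs_def adj_def)
    qed (auto simp: out_arcs_def)
    finally show "N \<le> degree_into adj V u" using deg by (simp add: degree_into_def N_def m_def)
  qed
  obtain X :: "nat \<Rightarrow> 'a set" where X: "\<forall>s. X s \<subseteq> V" "\<forall>s. X s \<noteq> {}" "antimono X"
    "\<forall>s. \<forall>u \<in> X s. degree_into adj (V - X s) u \<le> s"
    and X_cut: "\<forall>s Y Z. Y \<inter> Z = {} \<longrightarrow> Y \<inter> X s \<noteq> {} \<longrightarrow> Z \<inter> X s \<noteq> {} \<longrightarrow> s < mixed_cut adj V Y Z"
    using nested_regions[OF fin ne sym] by (elim exE conjE)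
  obtain t :: "nat \<Rightarrow> 'b" and par where t: "bij_betw t {..<m} (pverts T)"
    and par: "\<forall>i. 0 < i \<longrightarrow> i < m \<longrightarrow> par i < i"
    and arcs: "\<forall>p i. p < i \<longrightarrow> i < m \<longrightarrow> ((t p, t i) \<in> parcs T \<longleftrightarrow> p = par i)"
    using tree_enumeration[OF T] unfolding m_def by (elim exE conjE)
  obtain g where g: "inj_on g {..<m}" "g ` {..<m} \<subseteq> V"
    and g_edge: "\<forall>q. 0 < q \<longrightarrow> q < m \<longrightarrow>
      g q \<in> X (N - q) \<and> g (par q) \<in> X (N - q) \<and> adj (g (par q)) (g q)"
    using embed_in_nested_regions[OF fin sym irrefl degN X m par] by (elim exE conjE)
  define idx where "idx = the_inv_into {..<m} t"
  have idx: "idx v < m" "t (idx v) = v" if "v \<in> pverts T" for v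
    using that t unfolding idx_def bij_betw_def
    by (auto simp: f_the_inv_into_f intro: the_inv_into_into[of t "{..<m}" v "{..<m}", simplified])
  define f where "f = g \<circ> idx"
  have f_inj: "inj_on f (pverts T)"
    unfolding f_def
  proof (rule comp_inj_on)
    show "inj_on idx (pverts T)" using idx(2) by (rule inj_on_inverseI)
    show "inj_on g (idx ` pverts T)" using g(1) idx(1) by (auto intro: inj_on_subset)
  qed
  define T' where "T' = \<lparr>pverts = f ` pverts T, parcs = (\<lambda>(u, v). (f u, f v)) ` parcs T\<rparr>"
  have T': "tree_graph T'" "graph_isomorphic T T'"
    using graph_image_of_tree[OF T f_inj] by (simp_all add: T'_def)
  interpret T': pair_graph T' using T' by (simp add: tree_graph_def)
  have T'_arc: "\<exists>q. 0 < q \<and> q < m \<and> (a = g (par q) \<and> b = g q \<or> a = g q \<and> b = g (par q))"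
    if ab: "(a, b) \<in> parcs T'" for a b
  proof -
    obtain u v where uv: "(u, v) \<in> parcs T" "a = f u" "b = f v" using ab by (auto simp: T'_def)
    have V: "u \<in> pverts T" "v \<in> pverts T" "u \<noteq> v"
      using uv T.in_arcsD1 T.in_arcsD2 T.pair_no_loops[of "(u, v)"] by auto
    have vu: "(v, u) \<in> parcs T" using T.graph_symmetric uv by simp
    have "t (idx u) \<noteq> t (idx v)" using V idx by simp
    then have "idx u \<noteq> idx v" by auto
    then consider "idx u < idx v" | "idx v < idx u" by linarith
    then show ?thesis
    proof cases
      case 1
      then have "idx u = par (idx v)" using arcs[rule_format, of "idx u" "idx v"] uv V idx by simp
      then show ?thesis using 1 uv V idx by (intro exI[of _ "idx v"]) (auto simp: f_def)
    next
      case 2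
      then have "idx v = par (idx u)" using arcs[rule_format, of "idx v" "idx u"] vu V idx by simp
      then show ?thesis using 2 uv V idx by (intro exI[of _ "idx u"]) (auto simp: f_def)
    qed
  qed
  have sub: "parcs T' \<subseteq> parcs G"
  proof
    fix e assume "e \<in> parcs T'"
    then obtain a b where ab: "e = (a, b)" "(a, b) \<in> parcs T'" by (cases e) auto
    then show "e \<in> parcs G" using T'_arc[OF ab(2)] g_edge G.graph_symmetric by (auto simp: adj_def)
  qed
  have "pverts T' \<subseteq> pverts G" using g(2) idx by (auto simp: T'_def f_def V_def)
  then have "subgraph (with_proj T') (with_proj G)"
    using sub by (auto simp: subgraph_def compatible_def T'.wf_digraph_axioms G.wf_digraph_axioms)
  then have "subtree_of T' G" using T' by (simp add: subtree_of_def)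
  moreover have "k \<le> card (V - Y - Z) + card ((Y \<times> Z) \<inter> (parcs G - parcs T'))"
    if YZ: "Y \<inter> Z = {}" and crossed: "(Y \<times> Z) \<inter> parcs T' \<noteq> {}" for Y Z
  proof -
    \<comment> \<open>The tree edges that cross between \<open>Y\<close> and \<open>Z\<close>, named by the nodes that they add.\<close>
    define Q where "Q = {q. 0 < q \<and> q < m \<and>
      (g (par q) \<in> Y \<and> g q \<in> Z \<or> g q \<in> Y \<and> g (par q) \<in> Z)}"
    have finQ: "finite Q" by (simp add: Q_def)
    have "Q \<noteq> {}" using crossed T'_arc unfolding Q_def by fastforce
    then have MinQ: "Min Q \<in> Q" using finQ by simp
    define q where "q = Min Q"
    have q: "0 < q" "q < m" using MinQ by (auto simp: Q_def q_def)
    have "Y \<inter> X (N - q) \<noteq> {}" "Z \<inter> X (N - q) \<noteq> {}"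
      using MinQ g_edge q by (auto simp: Q_def q_def)
    then have cut: "N - q < mixed_cut adj V Y Z" using X_cut YZ by blast
    have "(Y \<times> Z) \<inter> parcs T' \<subseteq>
      (\<lambda>q. if g q \<in> Z then (g (par q), g q) else (g q, g (par q))) ` Q"
    proof
      fix e assume "e \<in> (Y \<times> Z) \<inter> parcs T'"
      then obtain a b where ab: "e = (a, b)" "(a, b) \<in> parcs T'" "a \<in> Y" "b \<in> Z" by auto
      then obtain q where "0 < q" "q < m" "a = g (par q) \<and> b = g q \<or> a = g q \<and> b = g (par q)"
        using T'_arc by blast
      then show "e \<in> (\<lambda>q. if g q \<in> Z then (g (par q), g q) else (g q, g (par q))) ` Q"
        using ab YZ by (intro rev_image_eqI[of q]) (auto simp: Q_def)
    qed
    then have "card ((Y \<times> Z) \<inter> parcs T') \<le> card Q" using finQ by (rule surj_card_le[rotated])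
    also have "Q \<subseteq> {q..<m}" using Min_le[OF finQ] by (auto simp: Q_def q_def)
    then have "card Q \<le> m - q" using card_mono[of "{q..<m}" Q] by simp
    finally have few: "card ((Y \<times> Z) \<inter> parcs T') \<le> m - q" .
    have "{(a, b). a \<in> V \<inter> Y \<and> b \<in> V \<inter> Z \<and> adj a b}
        = ((Y \<times> Z) \<inter> parcs T') \<union> ((Y \<times> Z) \<inter> (parcs G - parcs T'))"
      using sub by (auto simp: adj_def V_def dest: G.in_arcsD1 G.in_arcsD2)
    then have "mixed_cut adj V Y Z \<le> card (V - Y - Z)
        + (card ((Y \<times> Z) \<inter> parcs T') + card ((Y \<times> Z) \<inter> (parcs G - parcs T')))"
      unfolding mixed_cut_def
      using card_Un_le[of "(Y \<times> Z) \<inter> parcs T'" "(Y \<times> Z) \<inter> (parcs G - parcs T')"] by simp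
    then show ?thesis using cut few q k by (simp add: N_def)
  qed
  ultimately show ?thesis using T'(2)
    by (intro exI[of _ T'] conjI allI impI) (simp_all flip: V_def)
qed

text \<open>
  Suppose that the residual graph is separated into \<open>Y\<close> and \<open>Z\<close> by fewer than \<open>k\<close>
  vertices, or by fewer than \<open>k\<close> edges. If an edge of the copy of the tree runs between them,
  the residual cut has size at least \<open>k\<close>, which is absurd; otherwise \<open>Y\<close> and \<open>Z\<close> are
  separated in the same way in \<open>G\<close> itself.
\<close>

theorem theorem1p1:
  fixes k m :: nat
    and G :: "'a pair_pre_digraph"
    and T :: "'b pair_pre_digraph"
  assumes "k \<ge> 1" and "m \<ge> 1"
    and "pair_graph G"
    and "tree_graph T" and "card (pverts T) = m"
    and "min_degree G \<ge> k + m - 1"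
  shows "(k_connected k G \<longrightarrow>
           (\<exists>T'. subtree_of T' G \<and> graph_isomorphic T T' \<and>
                 k_connected k (del_edges G (uedges T')))) \<and>
         (k_edge_connected k G \<longrightarrow>
           (\<exists>T'. subtree_of T' G \<and> graph_isomorphic T T' \<and>
                 k_edge_connected k (del_edges G (uedges T'))))"
proof -
  interpret G: pair_graph G by fact
  have symG: "sym (parcs G)" using G.graph_symmetric by (auto simp: sym_def)
  have residual: "\<exists>T'. subtree_of T' G \<and> graph_isomorphic T T' \<and>
      parcs (del_edges G (uedges T')) = parcs G - parcs T' \<and>
      (\<forall>Y Z. Y \<inter> Z = {} \<longrightarrow> (Y \<times> Z) \<inter> parcs T' \<noteq> {} \<longrightarrow>
        k \<le> card (pverts G - Y - Z) + card ((Y \<times> Z) \<inter> (parcs G - parcs T')))"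
    if nonempty: "pverts G \<noteq> {}"
  proof -
    have deg: "min_degree G \<ge> k + card (pverts T) - 1" using assms(5,6) by simp
    obtain T' where T': "subtree_of T' G" "graph_isomorphic T T'"
      "\<forall>Y Z. Y \<inter> Z = {} \<longrightarrow> (Y \<times> Z) \<inter> parcs T' \<noteq> {} \<longrightarrow>
        k \<le> card (pverts G - Y - Z) + card ((Y \<times> Z) \<inter> (parcs G - parcs T'))"
      using tree_embedding_with_residual_cuts[OF assms(3) nonempty assms(4,1) deg] by (elim exE conjE)
    interpret T': pair_graph T' using T' by (simp add: subtree_of_def tree_graph_def)
    have "{u, v} \<in> uedges T' \<longleftrightarrow> (u, v) \<in> parcs T'" for u v
      using T'.graph_symmetric by (auto simp: uedges_def doubleton_eq_iff)
    then have "parcs (del_edges G (uedges T')) = parcs G - parcs T'" by (auto simp: del_edges_def)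
    then show ?thesis using T' by blast
  qed
  have vertex_version: "\<exists>T'. subtree_of T' G \<and> graph_isomorphic T T' \<and> k_connected k (del_edges G (uedges T'))"
    if con: "k_connected k G"
  proof -
    have nonempty: "pverts G \<noteq> {}" using con by (auto simp: k_connected_def)
    obtain T' where T': "subtree_of T' G" "graph_isomorphic T T'"
      and arcs: "parcs (del_edges G (uedges T')) = parcs G - parcs T'"
      and cut: "\<forall>Y Z. Y \<inter> Z = {} \<longrightarrow> (Y \<times> Z) \<inter> parcs T' \<noteq> {} \<longrightarrow>
        k \<le> card (pverts G - Y - Z) + card ((Y \<times> Z) \<inter> (parcs G - parcs T'))"
      using residual[OF nonempty] by (elim exE conjE)
    have "Digraph_Component.connected (with_proj (del_edges G (uedges T')) \<restriction> (pverts G - S))"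
      if S: "S \<subseteq> pverts G" "card S < k" for S
    proof (rule connected_induced_if_crossing_arcs)
      have "card S < card (pverts G)" using S con by (simp add: k_connected_def)
      then show "pverts G - S \<noteq> {}" using S by auto
      fix Y Z assume YZ: "Y \<union> Z = pverts G - S" "Y \<inter> Z = {}" "Y \<noteq> {}" "Z \<noteq> {}"
      have "Digraph_Component.connected (with_proj G \<restriction> (pverts G - S))"
        using con S by (simp add: k_connected_def)
      then have crossing: "(Y \<times> Z) \<inter> parcs G \<noteq> {}"
        using connected_induced_crossing_arc[OF symG] YZ by blast
      have "pverts G - Y - Z = S" using YZ S by blast
      then show "(Y \<times> Z) \<inter> parcs (del_edges G (uedges T')) \<noteq> {}"
        using cut[rule_format, of Y Z] YZ(2) crossing S by (cases "(Y \<times> Z) \<inter> parcs T' = {}") (auto simp: arcs)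
    qed
    then have "k_connected k (del_edges G (uedges T'))"
      using con by (simp add: k_connected_def del_edges_def)
    then show ?thesis using T' by blast
  qed
  have edge_version: "\<exists>T'. subtree_of T' G \<and> graph_isomorphic T T' \<and> k_edge_connected k (del_edges G (uedges T'))"
    if con: "k_edge_connected k G"
  proof -
    have del_con: "Digraph_Component.connected (with_proj (del_edges G F) \<restriction> pverts G)"
      if "F \<subseteq> uedges G" "card F < k" for F
    proof -
      have "with_proj (del_edges G F) \<restriction> pverts (del_edges G F) = with_proj (del_edges G F)"
        by (rule induce_all_vertices) (auto simp: del_edges_def dest: G.in_arcsD1 G.in_arcsD2)
      then show ?thesis using con that by (simp add: k_edge_connected_def del_edges_def)
    qed
    have "Digraph_Component.connected (with_proj (del_edges G {}) \<restriction> pverts G)"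
      using del_con[of "{}"] assms(1) by simp
    then have nonempty: "pverts G \<noteq> {}" by (auto simp: connected_conv)
    obtain T' where T': "subtree_of T' G" "graph_isomorphic T T'"
      and arcs: "parcs (del_edges G (uedges T')) = parcs G - parcs T'"
      and cut: "\<forall>Y Z. Y \<inter> Z = {} \<longrightarrow> (Y \<times> Z) \<inter> parcs T' \<noteq> {} \<longrightarrow>
        k \<le> card (pverts G - Y - Z) + card ((Y \<times> Z) \<inter> (parcs G - parcs T'))"
      using residual[OF nonempty] by (elim exE conjE)
    define G' where "G' = del_edges G (uedges T')"
    have G': "pverts G' = pverts G" "parcs G' = parcs G - parcs T'"
      by (simp_all add: G'_def arcs) (simp add: del_edges_def)
    have "Digraph_Component.connected (with_proj (del_edges G' F))"
      if F: "F \<subseteq> uedges G'" "card F < k" for F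
    proof -
      have "uedges G' \<subseteq> uedges G" unfolding uedges_def G' by blast
      then have FG: "F \<subseteq> uedges G" using F by blast
      have "uedges G \<subseteq> (\<lambda>(u, v). {u, v}) ` parcs G" by (auto simp: uedges_def)
      then have finF: "finite F" using FG by (meson G.pair_finite_arcs finite_imageI finite_subset)
      have "Digraph_Component.connected (with_proj (del_edges G' F) \<restriction> pverts G)"
      proof (rule connected_induced_if_crossing_arcs)
        fix Y Z assume YZ: "Y \<union> Z = pverts G" "Y \<inter> Z = {}" "Y \<noteq> {}" "Z \<noteq> {}"
        show "(Y \<times> Z) \<inter> parcs (del_edges G' F) \<noteq> {}"
        proof
          assume none: "(Y \<times> Z) \<inter> parcs (del_edges G' F) = {}"
          \<comment> \<open>If no edge of \<open>T'\<close> crossed, then \<open>F\<close> alone would already disconnect \<open>G\<close>.\<close>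
          have "sym (parcs (del_edges G F))"
            using symG by (auto simp: sym_def del_edges_def insert_commute)
          then have "(Y \<times> Z) \<inter> parcs (del_edges G F) \<noteq> {}"
            using connected_induced_crossing_arc del_con[OF FG F(2)] YZ by blast
          then have "(Y \<times> Z) \<inter> parcs T' \<noteq> {}"
            using none G' by (auto simp: del_edges_def)
          then have "k \<le> card (pverts G - Y - Z) + card ((Y \<times> Z) \<inter> parcs G')"
            using cut YZ(2) G' by simp
          moreover have "pverts G - Y - Z = {}" using YZ by blast
          moreover have "card ((Y \<times> Z) \<inter> parcs G') \<le> card F"
          proof (rule card_inj_on_le)
            show "inj_on (\<lambda>(u, v). {u, v}) ((Y \<times> Z) \<inter> parcs G')"
              using YZ(2) by (auto simp: inj_on_def doubleton_eq_iff)
            show "(\<lambda>(u, v). {u, v}) ` ((Y \<times> Z) \<inter> parcs G') \<subseteq> F"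
              using none by (auto simp: del_edges_def)
          qed (rule finF)
          ultimately show False using F(2) by simp
        qed
      qed (rule nonempty)
      moreover have "with_proj (del_edges G' F) \<restriction> pverts (del_edges G' F) = with_proj (del_edges G' F)"
        by (rule induce_all_vertices) (auto simp: del_edges_def G' dest: G.in_arcsD1 G.in_arcsD2)
      ultimately show ?thesis by (simp add: del_edges_def G')
    qed
    then have "k_edge_connected k G'" by (simp add: k_edge_connected_def)
    then show ?thesis using T' unfolding G'_def by blast
  qed
  from vertex_version edge_version show ?thesis by blast
qed

end
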